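(* For each integer $k \geq 2$ one has $$F(k) = k + \lfloor \sqrt{2k-3} \rfloor + \epsilon_k,$$ where $\epsilon_k \in \{-1,0\}$, and where $F(k)$ denotes the maximum length of a $k$-separator, i.e. the largest $n \geq k$ for which there exists a permutation $\sigma \in S_n$ that is a $k$-separator.
   Context: For a positive integer $n$, $[n]=\{1,\dots,n\}$, and $S_n$ is the set of permutations of $[n]$, regarded as bijections $\sigma:[n]\to[n]$ and written $\sigma=\sigma_1\sigma_2\cdots\sigma_n$ with $\sigma_i=\sigma(i)$; $n$ is called the length of $\sigma$. Let $k \leq n$ be positive integers, $\sigma\in S_n$ and $\pi\in S_k$. A copy of the pattern $\pi$ in $\sigma$ is a $k$-tuple $(a_1,\dots,a_k)$ with $1\leq a_1<a_2<\cdots<a_k\leq n$ such that $\operatorname{sign}(\sigma_{a_j}-\sigma_{a_i})=\operatorname{sign}(\pi_j-\pi_i)$ for all $1\leq i<j\leq k$. Two copies are different if the corresponding $k$-tuples of positions $(a_1,\dots,a_k)$ are different. For $k\leq n$, a permutation $\sigma\in S_n$ is called a $k$-separator if it contains at most one copy of any $\pi\in S_k$ (equivalently, distinct $k$-element sets of positions in $\sigma$ give distinct patterns in $S_k$). *)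

theory Defs
  imports Complex_Main "HOL-Combinatorics.Permutations" "HOL-Library.FuncSet"
begin

text \<open>
  A permutation of \<open>[n]\<close> is a function \<open>nat \<Rightarrow> nat\<close> with \<open>\<sigma> permutes {1..n}\<close>,
  so it is the identity outside \<open>{1..n}\<close>.
  A tuple of positions \<open>(a\<^sub>1, \<dots>, a\<^sub>k)\<close> is an extensional function on \<open>{1..k}\<close>, so that
  equality of functions is equality of tuples.
\<close>

definition pattern_copies ::
    "nat \<Rightarrow> (nat \<Rightarrow> nat) \<Rightarrow> nat \<Rightarrow> (nat \<Rightarrow> nat) \<Rightarrow> (nat \<Rightarrow> nat) set" where
  "pattern_copies k \<pi> n \<sigma> =
     {a \<in> {1..k} \<rightarrow>\<^sub>E {1..n}. strict_mono_on {1..k} a \<and>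
        (\<forall>i\<in>{1..k}. \<forall>j\<in>{1..k}. i < j \<longrightarrow>
           sgn (int (\<sigma> (a j)) - int (\<sigma> (a i))) = sgn (int (\<pi> j) - int (\<pi> i)))}"

definition separator :: "nat \<Rightarrow> nat \<Rightarrow> (nat \<Rightarrow> nat) \<Rightarrow> bool" where
  "separator k n \<sigma> \<longleftrightarrow>
     k \<le> n \<and> \<sigma> permutes {1..n} \<and>
     (\<forall>\<pi>. \<pi> permutes {1..k} \<longrightarrow> (\<exists>\<^sub>\<le>\<^sub>1 a. a \<in> pattern_copies k \<pi> n \<sigma>))"

definition separator_lengths :: "nat \<Rightarrow> nat set" where
  "separator_lengths k = {n. \<exists>\<sigma>. separator k n \<sigma>}"

text \<open>
  \<open>Max\<close> is meaningful only for a finite nonempty set; that the maximum is attained is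
  therefore to be asserted wherever \<open>F\<close> is used.
\<close>

definition F :: "nat \<Rightarrow> nat" where
  "F k = Max (separator_lengths k)"

end

theory Submission
  imports Defs "HOL-Library.Infinite_Set"
begin

text \<open>
  Put \<open>d = n - k\<close> and measure the distance of two points \<open>(i, \<sigma> i)\<close> in the \<open>l\<^sub>1\<close> norm.  If two points
  of a \<open>k\<close>-separator were at distance less than \<open>d + 2\<close>, then the at most \<open>d - 1\<close> points between them,
  horizontally or vertically, could be deleted together with either of the two, giving the same pattern.
  Joining the first \<open>d + 2\<close> points by order of height and comparing the total height with \<open>n - 1\<close>
  gives \<open>d\<^sup>2 \<le> 2 k - 3\<close>.

  For the lower bound take a lattice \<open>{(x, y). y \<equiv> a x (mod N)}\<close> of minimal norm \<open>m = d + 2\<close>, with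
  \<open>(N, a) = (m\<^sup>2/2, m - 1)\<close> for even \<open>m\<close> and \<open>(N, a) = ((m\<^sup>2 + 1)/2, m)\<close> for odd \<open>m\<close>, and let \<open>\<sigma>\<close>
  sort \<open>1, \<dots>, n\<close> by the residue of \<open>a x\<close>, where \<open>n \<ge> N\<close>.  Two copies of a pattern in \<open>\<sigma>\<close> give an
  order isomorphism \<open>g\<close> between the points of the copies, which moves points by at most \<open>d\<close> in each
  direction.  The few lattice vectors of this size have both coordinates about \<open>m/2\<close>, and this forces
  \<open>g\<close> to be the identity.
\<close>

section \<open>Upper bound\<close>

definition rank :: "('a \<Rightarrow> nat) \<Rightarrow> 'a set \<Rightarrow> 'a \<Rightarrow> nat" where
  "rank \<kappa> A x = card {w \<in> A. \<kappa> w \<le> \<kappa> x}"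

lemma rank_less_iff:
  assumes "finite A" "x \<in> A" "y \<in> A"
  shows "rank \<kappa> A x < rank \<kappa> A y \<longleftrightarrow> \<kappa> x < \<kappa> y"
proof
  assume "\<kappa> x < \<kappa> y"
  then have "{w \<in> A. \<kappa> w \<le> \<kappa> x} \<subset> {w \<in> A. \<kappa> w \<le> \<kappa> y}"
    using \<open>y \<in> A\<close> by force
  then show "rank \<kappa> A x < rank \<kappa> A y"
    unfolding rank_def using \<open>finite A\<close> by (simp add: psubset_card_mono)
next
  assume less: "rank \<kappa> A x < rank \<kappa> A y"
  show "\<kappa> x < \<kappa> y"
  proof (rule ccontr)
    assume "\<not> \<kappa> x < \<kappa> y"
    then have "rank \<kappa> A y \<le> rank \<kappa> A x"
      unfolding rank_def using \<open>finite A\<close> by (intro card_mono) auto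
    then show False using less by simp
  qed
qed

text \<open>Supplies both the pattern of a given tuple of positions and, later, the lattice
  permutation.\<close>

lemma ex_permutes_rank:
  assumes inj: "inj_on \<kappa> {1..n}"
  shows "\<exists>\<pi>. \<pi> permutes {1..n} \<and> (\<forall>x\<in>{1..n}. \<pi> x = rank \<kappa> {1..n} x)"
proof -
  let ?N = "{1..n}"
  let ?\<pi> = "\<lambda>x. if x \<in> ?N then rank \<kappa> ?N x else x"
  have "rank \<kappa> ?N x \<in> ?N" if "x \<in> ?N" for x
  proof -
    have "card {w \<in> ?N. \<kappa> w \<le> \<kappa> x} \<noteq> 0" using that by auto
    moreover have "card {w \<in> ?N. \<kappa> w \<le> \<kappa> x} \<le> card ?N" by (intro card_mono) auto
    ultimately show ?thesis unfolding rank_def atLeastAtMost_iff card_atLeastAtMost by linarith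
  qed
  moreover have "inj_on (rank \<kappa> ?N) ?N"
  proof (rule inj_onI)
    fix x y assume "x \<in> ?N" "y \<in> ?N" "rank \<kappa> ?N x = rank \<kappa> ?N y"
    then show "x = y"
      using rank_less_iff[of ?N x y \<kappa>] rank_less_iff[of ?N y x \<kappa>] inj_onD[OF inj] by force
  qed
  ultimately have "bij_betw (rank \<kappa> ?N) ?N ?N"
    by (metis finite_atLeastAtMost bij_betw_imageI endo_inj_surj image_subsetI)
  then have "bij_betw ?\<pi> ?N ?N" using bij_betw_cong[of ?N ?\<pi> "rank \<kappa> ?N" ?N] by simp
  then have "?\<pi> permutes ?N" by (rule bij_imp_permutes) auto
  then show ?thesis by (intro exI[of _ ?\<pi>]) auto
qed

lemma pattern_copiesI:
  assumes "a \<in> {1..k} \<rightarrow>\<^sub>E {1..n}" "strict_mono_on {1..k} a"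
    and iff: "\<And>i j. i \<in> {1..k} \<Longrightarrow> j \<in> {1..k} \<Longrightarrow> \<pi> i < \<pi> j \<longleftrightarrow> \<sigma> (a i) < \<sigma> (a j)"
  shows "a \<in> pattern_copies k \<pi> n \<sigma>"
proof -
  have "sgn (int (\<sigma> (a j)) - int (\<sigma> (a i))) = sgn (int (\<pi> j) - int (\<pi> i))"
    if "i \<in> {1..k}" "j \<in> {1..k}" for i j
    using iff[OF that] iff[OF that(2,1)] by (auto simp: sgn_if)
  then show ?thesis using assms unfolding pattern_copies_def by blast
qed

lemma ex_strict_mono_enumeration:
  fixes S :: "nat set"
  assumes "finite S" "card S = k"
  shows "\<exists>a \<in> {1..k} \<rightarrow>\<^sub>E S. strict_mono_on {1..k} a \<and> a ` {1..k} = S"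
proof -
  obtain h where h: "bij_betw h {..<k} S" "strict_mono_on {..<k} h"
    using ex_bij_betw_strict_mono_card[OF assms(1)] assms(2) by blast
  let ?a = "restrict (\<lambda>t. h (t - 1)) {1..k}"
  have "strict_mono_on {1..k} ?a"
    using strict_mono_onD[OF h(2)] by (intro strict_mono_onI) auto
  moreover have "(\<lambda>t. t - 1) ` {1..k} = {..<k}"
    by (force simp: image_iff intro: bexI[of _ "Suc _"])
  then have "?a ` {1..k} = S"
    using bij_betw_imp_surj_on[OF h(1)] by (metis image_image image_restrict_eq)
  ultimately show ?thesis by (intro bexI[of _ ?a]) (auto simp del: image_restrict_eq)
qed

text \<open>With \<open>n = k + d\<close>, a closer pair has at most \<open>d - 1\<close> points
  between its columns or rows, so \<open>k - 1\<close> points \<open>C\<close> remain. Each of them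
  is on the same side of both \<open>i\<close> and \<open>j\<close>, so \<open>insert i C\<close>
  and \<open>insert j C\<close> show the same pattern.\<close>

lemma separator_far:
  assumes sep: "separator k n \<sigma>" and "1 \<le> k" and i: "i \<in> {1..n}" and j: "j \<in> {1..n}" and "i < j"
  shows "int n - int k + 2 \<le> int j - int i + \<bar>int (\<sigma> j) - int (\<sigma> i)\<bar>"
proof (rule ccontr)
  assume close: "\<not> ?thesis"
  have \<sigma>: "\<sigma> permutes {1..n}" and "k \<le> n" using sep unfolding separator_def by auto
  have inj: "inj \<sigma>" using \<sigma> permutes_inj by blast
  define lo hi where "lo = min (\<sigma> i) (\<sigma> j)" and "hi = max (\<sigma> i) (\<sigma> j)"
  have ne: "\<sigma> i \<noteq> \<sigma> j" using inj \<open>i < j\<close> by (metis injD less_irrefl)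
  define B where "B = {l \<in> {1..n}. \<sigma> l \<in> {lo<..<hi}}"
  have "card B \<le> card {lo<..<hi}"
    using inj inj_on_subset by (intro card_inj_on_le[of \<sigma>]) (auto simp: B_def)
  moreover have "card ({i<..<j} \<union> B \<union> {i, j}) \<le> card {i<..<j} + card B + card {i, j}"
    using card_Un_le[of "{i<..<j} \<union> B" "{i, j}"] card_Un_le[of "{i<..<j}" B] by linarith
  ultimately have "card ({i<..<j} \<union> B \<union> {i, j}) + k \<le> n + 1"
    using close \<open>i < j\<close> ne unfolding lo_def hi_def by auto
  moreover have "card {1..n} - card ({i<..<j} \<union> B \<union> {i, j}) \<le> card ({1..n} - ({i<..<j} \<union> B \<union> {i, j}))"
    by (intro diff_card_le_card_Diff) (auto simp: B_def)
  ultimately have "k - 1 \<le> card ({1..n} - ({i<..<j} \<union> B \<union> {i, j}))" by simp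
  then obtain C where C: "C \<subseteq> {1..n} - ({i<..<j} \<union> B \<union> {i, j})" "card C = k - 1" "finite C"
    by (rule obtain_subset_with_card_n)
  have "i \<notin> C" using C(1) by auto
  then have "card (insert i C) = k" using C(2,3) \<open>1 \<le> k\<close> by simp
  then obtain a where a: "a \<in> {1..k} \<rightarrow>\<^sub>E insert i C" "strict_mono_on {1..k} a" "a ` {1..k} = insert i C"
    using ex_strict_mono_enumeration[of "insert i C" k] C(3) by auto
  define f where "f z = (if z = i then j else z)" for z
  have f: "f z < f w \<longleftrightarrow> z < w" "\<sigma> (f z) < \<sigma> (f w) \<longleftrightarrow> \<sigma> z < \<sigma> w"
    if "z \<in> insert i C" "w \<in> insert i C" for z w
  proof -
    have *: "c \<noteq> i \<and> c \<noteq> j \<and> \<sigma> c \<noteq> \<sigma> i \<and> \<sigma> c \<noteq> \<sigma> j \<and> (c < i \<longleftrightarrow> c < j) \<and> (\<sigma> c < \<sigma> i \<longleftrightarrow> \<sigma> c < \<sigma> j)" if "c \<in> C" for c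
    proof -
      have "c \<in> {1..n}" "c \<notin> {i<..<j}" "c \<notin> B" "c \<noteq> i" "c \<noteq> j" using that C by auto
      moreover from this have "\<sigma> c \<noteq> \<sigma> i" "\<sigma> c \<noteq> \<sigma> j" using inj by (auto dest: injD)
      ultimately show ?thesis using \<open>i < j\<close> unfolding B_def lo_def hi_def by auto
    qed
    show "f z < f w \<longleftrightarrow> z < w" "\<sigma> (f z) < \<sigma> (f w) \<longleftrightarrow> \<sigma> z < \<sigma> w"
      using that *[of z] *[of w] unfolding f_def by (auto split: if_splits)
  qed
  define b where "b = restrict (f \<circ> a) {1..k}"
  have ain: "a t \<in> insert i C" if "t \<in> {1..k}" for t using a that by auto
  have "inj_on (\<sigma> \<circ> a) {1..k}"
    using a(2) inj by (intro comp_inj_on) (auto intro: strict_mono_on_imp_inj_on inj_on_subset)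
  then obtain \<pi> where \<pi>: "\<pi> permutes {1..k}" "\<And>t. t \<in> {1..k} \<Longrightarrow> \<pi> t = rank (\<sigma> \<circ> a) {1..k} t"
    using ex_permutes_rank by blast
  have \<pi>_less: "\<pi> s < \<pi> t \<longleftrightarrow> \<sigma> (a s) < \<sigma> (a t)" if "s \<in> {1..k}" "t \<in> {1..k}" for s t
    using rank_less_iff[OF _ that, of "\<sigma> \<circ> a"] \<pi>(2) that by simp
  have "a \<in> pattern_copies k \<pi> n \<sigma>"
  proof (rule pattern_copiesI)
    show "a \<in> {1..k} \<rightarrow>\<^sub>E {1..n}" using PiE_mono[of "{1..k}" "\<lambda>_. insert i C" "\<lambda>_. {1..n}"] a(1) C(1) i by blast
  qed (use a(2) \<pi>_less in auto)
  moreover have "b \<in> pattern_copies k \<pi> n \<sigma>"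
  proof (rule pattern_copiesI)
    have "f z \<in> {1..n}" if "z \<in> insert i C" for z using that C i j unfolding f_def by auto
    then show "b \<in> {1..k} \<rightarrow>\<^sub>E {1..n}" using ain unfolding b_def by auto
    show "strict_mono_on {1..k} b"
      using a(2) f(1) ain unfolding b_def strict_mono_on_def by simp
    show "\<pi> s < \<pi> t \<longleftrightarrow> \<sigma> (b s) < \<sigma> (b t)" if "s \<in> {1..k}" "t \<in> {1..k}" for s t
      using \<pi>_less f(2) ain that unfolding b_def by simp
  qed
  ultimately have "a = b" using sep \<pi>(1) unfolding separator_def Uniq_def by blast
  obtain t where "t \<in> {1..k}" "a t = i" using a(3) by (metis imageE insertI1)
  then have "b t = j" unfolding b_def f_def by simp
  then show False using \<open>a t = i\<close> \<open>a = b\<close> \<open>i < j\<close> by simp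
qed

text \<open>Removing both ends of the range for \<open>m + 2\<close> and shifting by one leaves the
  sum for \<open>m\<close>; each end contributes \<open>m + 1\<close>. Doubled distances stay
  integral.\<close>

lemma sum_dist_centre: "(\<Sum>t=1..m. \<bar>2 * int t - (int m + 1)\<bar>) = (int m)\<^sup>2 div 2"
proof (induction m rule: induct_nat_012)
  case (ge2 m)
  let ?f = "\<lambda>t. \<bar>2 * int t - (int (Suc (Suc m)) + 1)\<bar>"
  have "(\<Sum>t=1..Suc (Suc m). ?f t) = ?f 1 + (\<Sum>t=Suc 1..Suc m. ?f t) + ?f (Suc (Suc m))"
    using sum.atLeast_Suc_atMost[of 1 "Suc m" ?f] by (simp del: of_nat_Suc)
  also have "(\<Sum>t=Suc 1..Suc m. ?f t) = (\<Sum>t=1..m. ?f (Suc t))"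
    by (rule sum.shift_bounds_cl_Suc_ivl)
  also have "(\<Sum>t=1..m. ?f (Suc t)) = (\<Sum>t=1..m. \<bar>2 * int t - (int m + 1)\<bar>)"
    by (intro sum.cong) auto
  finally have "(\<Sum>t=1..Suc (Suc m). ?f t) = (int m)\<^sup>2 div 2 + 2 * (int m + 1)"
    using ge2 by simp
  also have "\<dots> = (int m ^ 2 + 2 * (2 * (int m + 1))) div 2" by simp
  also have "int m ^ 2 + 2 * (2 * (int m + 1)) = (int (Suc (Suc m)))\<^sup>2"
    by (simp add: power2_eq_square algebra_simps)
  finally show ?case .
qed auto

lemma separator_bound:
  assumes sep: "separator k (k + d) \<sigma>" and "2 \<le> k"
  shows "d\<^sup>2 + 3 \<le> 2 * k"
proof -
  define q where "q = d + 1"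
  define n where "n = k + d"
  have \<sigma>: "\<sigma> permutes {1..n}" using sep unfolding separator_def n_def by auto
  \<comment> \<open>Here \<open>2 \<le> k\<close> provides the \<open>d + 2\<close> columns.\<close>
  have m: "Suc q \<le> n" using \<open>2 \<le> k\<close> unfolding q_def n_def by simp
  have inj: "inj_on \<sigma> {1..Suc q}" using permutes_inj[OF \<sigma>] inj_on_subset by blast
  have "card (\<sigma> ` {1..Suc q}) = Suc q" using card_image[OF inj] by simp
  then obtain h where h: "bij_betw h {..<Suc q} (\<sigma> ` {1..Suc q})" "strict_mono_on {..<Suc q} h"
    using ex_bij_betw_strict_mono_card[of "\<sigma> ` {1..Suc q}"] by auto
  define e where "e = inv_into {1..Suc q} \<sigma> \<circ> h"
  have e: "bij_betw e {..<Suc q} {1..Suc q}"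
    unfolding e_def using h(1) inj
    by (intro bij_betw_trans[OF h(1)] bij_betw_inv_into) (simp add: bij_betw_def)
  have \<sigma>e: "\<sigma> (e i) = h i" if "i < Suc q" for i
    using bij_betw_apply[OF h(1)] that unfolding e_def by (simp add: f_inv_into_f)
  have ein: "e i \<in> {1..Suc q}" if "i < Suc q" for i using e that bij_betwE by blast
  have einn: "e i \<in> {1..n}" if "i < Suc q" for i using ein[OF that] m by auto
  \<comment> \<open>Twice the distance of column \<open>t\<close> from the middle of the
    \<open>q + 1\<close> columns; the triangle inequality through the middle bounds horizontal
    distances.\<close>
  define c where "c t = \<bar>2 * int t - (int (Suc q) + 1)\<bar>" for t
  have step: "2 * int (Suc q) \<le> c (e (Suc i)) + c (e i) + 2 * (int (h (Suc i)) - int (h i))" if "i < q" for i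
  proof -
    have "h i < h (Suc i)" using h(2) that unfolding strict_mono_on_def by simp
    have "e i \<noteq> e (Suc i)"
      using inj_onD[OF bij_betw_imp_inj_on[OF e], of i "Suc i"] that by auto
    then have "int n - int k + 2 \<le> \<bar>int (e (Suc i)) - int (e i)\<bar> + \<bar>int (h (Suc i)) - int (h i)\<bar>"
      using separator_far[OF sep[folded n_def] _ einn einn, of i "Suc i"]
        separator_far[OF sep[folded n_def] _ einn einn, of "Suc i" i] \<sigma>e that \<open>2 \<le> k\<close>
      by (cases "e i < e (Suc i)") auto
    moreover have "2 * \<bar>x - y\<bar> \<le> \<bar>2 * x - z\<bar> + \<bar>2 * y - z\<bar>" for x y z :: int by arith
    from this[of "int (e (Suc i))" "int (e i)" "int (Suc q) + 1"]
    have "2 * \<bar>int (e (Suc i)) - int (e i)\<bar> \<le> c (e (Suc i)) + c (e i)" unfolding c_def .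
    ultimately show ?thesis using \<open>h i < h (Suc i)\<close> unfolding n_def q_def by simp
  qed
  have Z: "(\<Sum>i<Suc q. c (e i)) = (int (Suc q))\<^sup>2 div 2"
    using sum.reindex_bij_betw[OF e, of c] sum_dist_centre[of "Suc q"] unfolding c_def by simp
  have "2 * int (Suc q) * int q = (\<Sum>i<q. 2 * int (Suc q))" by simp
  also have "\<dots> \<le> (\<Sum>i<q. c (e (Suc i)) + c (e i) + 2 * (int (h (Suc i)) - int (h i)))"
    using step by (intro sum_mono) auto
  also have "\<dots> = (\<Sum>i<q. c (e (Suc i))) + (\<Sum>i<q. c (e i)) + 2 * (\<Sum>i<q. int (h (Suc i)) - int (h i))"
    by (simp add: sum.distrib sum_distrib_left)
  \<comment> \<open>Together the two sums count every column twice, except those of the lowest and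
    the highest point, counted once.\<close>
  also have "(\<Sum>i<q. c (e (Suc i))) = (int (Suc q))\<^sup>2 div 2 - c (e 0)"
    using Z by (simp add: sum.lessThan_Suc_shift del: sum.lessThan_Suc)
  also have "(\<Sum>i<q. c (e i)) = (int (Suc q))\<^sup>2 div 2 - c (e q)" using Z by simp
  also have "(\<Sum>i<q. int (h (Suc i)) - int (h i)) = int (h q) - int (h 0)"
    by (rule sum_lessThan_telescope)
  finally have main: "2 * int (Suc q) * int q \<le> 2 * ((int (Suc q))\<^sup>2 div 2) - c (e 0) - c (e q) + 2 * (int (h q) - int (h 0))"
    by simp
  have "h i \<in> {1..n}" if "i < Suc q" for i
    using \<sigma>e[OF that] einn[OF that] permutes_in_image[OF \<sigma>] by metis
  from this[of q] this[of 0] have range: "int (h q) - int (h 0) \<le> int n - 1" by auto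
  \<comment> \<open>Gains the unit that turns \<open>+ 2\<close> into \<open>+ 3\<close> in the
    result: for even \<open>q + 1\<close> both end terms are odd, hence positive; for odd
    \<open>q + 1\<close> the halving rounds down.\<close>
  have ends: "2 * ((int (Suc q))\<^sup>2 div 2) - c (e 0) - c (e q) \<le> (int (Suc q))\<^sup>2 - 1"
  proof (cases "even (Suc q)")
    case True
    then have "c t \<ge> 1" for t unfolding c_def by presburger
    from this[of "e 0"] this[of "e q"] show ?thesis using True by simp
  next
    case False
    then have "odd ((int (Suc q))\<^sup>2)" by simp
    then have "2 * ((int (Suc q))\<^sup>2 div 2) = (int (Suc q))\<^sup>2 - 1"
      using odd_two_times_div_two_succ eq_diff_eq by blast
    then show ?thesis unfolding c_def by simp
  qed
  have "2 * int (Suc q) * int q \<le> (int (Suc q))\<^sup>2 - 1 + 2 * (int n - 1)"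
    by (rule order_trans[OF main]) (intro add_mono ends, use range in simp)
  then have "(int d)\<^sup>2 + 3 \<le> 2 * int k" unfolding q_def n_def by (simp add: power2_eq_square algebra_simps)
  then have "int (d\<^sup>2 + 3) \<le> int (2 * k)" by simp
  then show ?thesis by (simp only: of_nat_le_iff)
qed

section \<open>Order isomorphisms between large subsets of a spread point set\<close>

lemma finite_has_least_image:
  fixes f :: "'a \<Rightarrow> 'b::linorder"
  assumes "finite A" "A \<noteq> {}"
  shows "\<exists>a\<in>A. \<forall>b\<in>A. f a \<le> f b"
  using obtains_MIN[OF assms, of f] assms(1) by (metis Min_le finite_imageI imageI)

section \<open>Chains of an order isomorphism\<close>

locale shift =
  fixes P X T :: "'a set" and g :: "'a \<Rightarrow> 'a"
  assumes finite_P: "finite P" and X_sub: "X \<subseteq> P" and T_sub: "T \<subseteq> P"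
    and inj_g: "inj_on g T" and image_g: "g ` T = P - X"
begin

text \<open>
  \<open>P\<close> is a set of points, and \<open>g\<close> maps the points that survive one deletion onto those that survive
  another.  It decomposes the moved points into chains \<open>r, g r, g (g r), \<dots>\<close>, each starting at a
  point of \<open>X\<close>.
\<close>

definition G :: "('a \<times> 'a) set" where "G = {(z, g z) | z. z \<in> T}"

text \<open>Meaningful only if the chain of \<open>z\<close> starts in \<open>X\<close>; a fixed
  point of \<open>g\<close> has no such \<open>r\<close>.\<close>

definition root :: "'a \<Rightarrow> 'a" where "root z = (SOME r. r \<in> X \<and> (r, z) \<in> G\<^sup>*)"

definition isotone :: "('a \<Rightarrow> int) \<Rightarrow> bool" where
  "isotone \<kappa> \<longleftrightarrow> inj_on \<kappa> P \<and> (\<forall>z\<in>T. \<forall>w\<in>T. \<kappa> z < \<kappa> w \<longleftrightarrow> \<kappa> (g z) < \<kappa> (g w))"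

text \<open>Half-open, so that for \<open>p\<close> moved upwards it contains \<open>p\<close> but
  not \<open>g p\<close>, and a chain meets it at most once.\<close>

definition strip :: "('a \<Rightarrow> int) \<Rightarrow> 'a \<Rightarrow> 'a set" where
  "strip \<kappa> p = {z \<in> P. \<kappa> p \<le> \<kappa> z \<and> \<kappa> z < \<kappa> (g p)}"

lemma g_in: "z \<in> T \<Longrightarrow> g z \<in> P - X"
  using image_g by blast

lemma isotone_le: "isotone \<kappa> \<Longrightarrow> z \<in> T \<Longrightarrow> w \<in> T \<Longrightarrow> \<kappa> z \<le> \<kappa> w \<longleftrightarrow> \<kappa> (g z) \<le> \<kappa> (g w)"
  unfolding isotone_def by (meson linorder_not_less)

lemma isotone_less: "isotone \<kappa> \<Longrightarrow> z \<in> T \<Longrightarrow> w \<in> T \<Longrightarrow> \<kappa> z < \<kappa> w \<longleftrightarrow> \<kappa> (g z) < \<kappa> (g w)"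
  unfolding isotone_def by blast

lemma single_valued_G: "single_valued G"
  unfolding G_def single_valued_def by auto

text \<open>If \<open>w = g u\<close> moves up, then so does \<open>u\<close>, which lies lower. By
  finiteness this descent ends, necessarily at a point outside the image of
  \<open>g\<close>.\<close>

lemma root_exists_mover:
  assumes \<kappa>: "isotone \<kappa>" and "w \<in> T" "\<kappa> w < \<kappa> (g w)"
  shows "\<exists>r\<in>X. (r, w) \<in> G\<^sup>*"
proof -
  let ?R = "inv_image finite_psubset (\<lambda>w. {u \<in> P. \<kappa> u < \<kappa> w})"
  have "wf ?R" by simp
  then show ?thesis using assms(2,3)
  proof (induction w rule: wf_induct_rule)
    case (less w)
    show ?case
    proof (cases "w \<in> X")
      case False
      then obtain u where u: "u \<in> T" "w = g u" using less.prems T_sub image_g by blast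
      have lt: "\<kappa> u < \<kappa> w" using less.prems u isotone_less[OF \<kappa>] by blast
      have "{v \<in> P. \<kappa> v < \<kappa> u} \<subset> {v \<in> P. \<kappa> v < \<kappa> w}" using lt u T_sub by force
      then have "(u, w) \<in> ?R" using finite_P by (simp add: finite_psubset_def)
      then obtain r where "r \<in> X" "(r, u) \<in> G\<^sup>*" using less.IH u lt by blast
      moreover have "(u, w) \<in> G" using u unfolding G_def by blast
      ultimately show ?thesis by (meson rtrancl.rtrancl_into_rtrancl)
    qed blast
  qed
qed

text \<open>If \<open>z = g u\<close> is in the strip, then \<open>u\<close> lies below
  \<open>p\<close>, hence moves up, and its chain starts in \<open>X\<close>.\<close>

lemma root_strip:
  assumes \<kappa>: "isotone \<kappa>" and p: "p \<in> T" and z: "z \<in> strip \<kappa> p"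
  shows "root z \<in> X" "(root z, z) \<in> G\<^sup>*"
proof -
  have "\<exists>r\<in>X. (r, z) \<in> G\<^sup>*"
  proof (cases "z \<in> X")
    case False
    then obtain u where u: "u \<in> T" "z = g u" using z image_g unfolding strip_def by blast
    have "\<kappa> u < \<kappa> p" using u z p isotone_less[OF \<kappa>] unfolding strip_def by simp
    then have "\<kappa> u < \<kappa> (g u)" using z u unfolding strip_def by auto
    then obtain r where "r \<in> X" "(r, u) \<in> G\<^sup>*" using root_exists_mover[OF \<kappa>] u by blast
    moreover have "(u, z) \<in> G" using u unfolding G_def by blast
    ultimately show ?thesis by (meson rtrancl.rtrancl_into_rtrancl)
  qed blast
  then have "root z \<in> X \<and> (root z, z) \<in> G\<^sup>*"
    unfolding root_def by (metis (mono_tags, lifting) someI)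
  then show "root z \<in> X" "(root z, z) \<in> G\<^sup>*" by auto
qed

text \<open>A point at or above \<open>p\<close> goes in one step to or above \<open>g p\<close>,
  which is itself above \<open>p\<close>, so later steps stay there.\<close>

lemma chain_leaves_strip:
  assumes \<kappa>: "isotone \<kappa>" and p: "p \<in> T" "\<kappa> p < \<kappa> (g p)" and zz: "(z, z') \<in> G\<^sup>+" and "\<kappa> p \<le> \<kappa> z"
  shows "\<kappa> (g p) \<le> \<kappa> z'"
  using zz
proof (induction rule: trancl_induct)
  case (base w)
  then show ?case using isotone_le[OF \<kappa>] assms(5) p unfolding G_def by auto
next
  case (step w v)
  then show ?case using isotone_le[OF \<kappa>] p unfolding G_def by force
qed

text \<open>Used in the contrapositive: a chain that reaches a higher point begins with an upward
  step.\<close>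

lemma chain_mono:
  assumes \<kappa>: "isotone \<kappa>" and zz: "(z, z') \<in> G\<^sup>+" and "\<kappa> (g z) \<le> \<kappa> z"
  shows "\<kappa> z' \<le> \<kappa> z"
proof -
  have "\<kappa> z' \<le> \<kappa> z \<and> (z' \<in> T \<longrightarrow> \<kappa> (g z') \<le> \<kappa> z')" using zz
  proof (induction rule: trancl_induct)
    case (base w)
    then have "z \<in> T" "w = g z" unfolding G_def by auto
    then show ?case using assms(3) isotone_le[OF \<kappa>] by auto
  next
    case (step w v)
    then have "w \<in> T" "v = g w" unfolding G_def by auto
    then show ?case using step isotone_le[OF \<kappa>] by auto
  qed
  then show ?thesis by blast
qed

lemma chain_comparable:
  assumes "(r, z) \<in> G\<^sup>*" "(r, z') \<in> G\<^sup>*"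
  shows "z = z' \<or> (z, z') \<in> G\<^sup>+ \<or> (z', z) \<in> G\<^sup>+"
  using single_valued_confluent[OF single_valued_G assms] by (metis rtranclD)

text \<open>Of two points on one chain, the later has already left the strip.\<close>

lemma inj_on_root:
  assumes \<kappa>: "isotone \<kappa>" and p: "p \<in> T" "\<kappa> p < \<kappa> (g p)"
  shows "inj_on root (strip \<kappa> p)"
proof (rule inj_onI)
  fix z z' assume z: "z \<in> strip \<kappa> p" and z': "z' \<in> strip \<kappa> p" and eq: "root z = root z'"
  have "(root z, z) \<in> G\<^sup>*" "(root z, z') \<in> G\<^sup>*"
    using root_strip(2)[OF \<kappa> p(1) z] root_strip(2)[OF \<kappa> p(1) z'] eq by auto
  from chain_comparable[OF this] show "z = z'"
    using chain_leaves_strip[OF \<kappa> p, of z z'] chain_leaves_strip[OF \<kappa> p, of z' z] z z'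
    unfolding strip_def by fastforce
qed

lemma card_strip_le:
  assumes \<kappa>: "isotone \<kappa>" and p: "p \<in> T" "\<kappa> p < \<kappa> (g p)"
  shows "card (strip \<kappa> p) \<le> card X"
  using card_inj_on_le[OF inj_on_root[OF assms]] root_strip(1)[OF \<kappa> p(1)] finite_P X_sub
  by (meson finite_subset image_subsetI)

lemma G_D: "(z, z') \<in> G \<Longrightarrow> z \<in> T \<and> z' = g z"
  unfolding G_def by auto

text \<open>All roots lie in \<open>X\<close>, so by inclusion-exclusion the strips share at least
  two of them, one not being that of \<open>p\<close>.\<close>

lemma common_chain:
  assumes \<kappa>: "isotone \<kappa>" and \<mu>: "isotone \<mu>" and p: "p \<in> T" "\<kappa> p < \<kappa> (g p)" "\<mu> p < \<mu> (g p)"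
    and card: "card X + 2 \<le> card (strip \<kappa> p) + card (strip \<mu> p)"
  obtains z z' where "z \<in> strip \<kappa> p" "z' \<in> strip \<mu> p" "z \<noteq> p" "z' \<noteq> p"
    "z = z' \<or> (z, z') \<in> G\<^sup>+ \<or> (z', z) \<in> G\<^sup>+"
proof -
  let ?H = "strip \<kappa> p" and ?V = "strip \<mu> p"
  have finX: "finite X" using finite_P X_sub finite_subset by blast
  have fin: "finite ?H" "finite ?V" using finite_P unfolding strip_def by auto
  have "card (root ` ?H \<union> root ` ?V) \<le> card X"
    using root_strip(1)[OF \<kappa> p(1)] root_strip(1)[OF \<mu> p(1)] by (intro card_mono finX) blast
  moreover have "card (root ` ?H) = card ?H" "card (root ` ?V) = card ?V"
    using inj_on_root[OF \<kappa> p(1,2)] inj_on_root[OF \<mu> p(1,3)] card_image by blast+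
  ultimately have "2 \<le> card (root ` ?H \<inter> root ` ?V)"
    using card_Un_Int[of "root ` ?H" "root ` ?V"] fin card by simp
  then have "\<not> root ` ?H \<inter> root ` ?V \<subseteq> {root p}"
    using card_mono[of "{root p}" "root ` ?H \<inter> root ` ?V"] by auto
  then obtain r where "r \<in> root ` ?H" "r \<in> root ` ?V" "r \<noteq> root p" by blast
  then obtain z z' where zz: "z \<in> ?H" "z' \<in> ?V" "root z = root z'" "root z \<noteq> root p" by fastforce
  then have "z = z' \<or> (z, z') \<in> G\<^sup>+ \<or> (z', z) \<in> G\<^sup>+"
    using chain_comparable[of "root z"] root_strip(2)[OF \<kappa> p(1), of z] root_strip(2)[OF \<mu> p(1), of z'] by simp
  then show ?thesis using that zz by metis
qed

end

text \<open>In the application \<open>\<rho>\<close> is the lattice residue and \<open>y\<close> the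
  rank in the induced order, which only widens gaps. The bounds in \<open>steps\<close> serve both
  parities of \<open>d\<close>; \<open>level\<close> handles equal residues.\<close>

locale shift_spread = shift +
  fixes x y \<rho> :: "'a \<Rightarrow> int" and n :: int and d :: nat
  assumes card_X: "card X = d"
    and x_bij: "bij_betw x P {1..n}" and y_bij: "bij_betw y P {1..n}"
    and x_iso: "\<And>z w. z \<in> T \<Longrightarrow> w \<in> T \<Longrightarrow> x z < x w \<longleftrightarrow> x (g z) < x (g w)"
    and y_iso: "\<And>z w. z \<in> T \<Longrightarrow> w \<in> T \<Longrightarrow> y z < y w \<longleftrightarrow> y (g z) < y (g w)"
    and y_expands: "\<And>z w. z \<in> P \<Longrightarrow> w \<in> P \<Longrightarrow> \<rho> z < \<rho> w \<Longrightarrow> \<rho> w - \<rho> z \<le> y w - y z"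
    and far: "\<And>z w. z \<in> P \<Longrightarrow> w \<in> P \<Longrightarrow> z \<noteq> w \<Longrightarrow> int d + 2 \<le> \<bar>x z - x w\<bar> + \<bar>\<rho> z - \<rho> w\<bar>"
    and steps: "\<And>z w. z \<in> P \<Longrightarrow> w \<in> P \<Longrightarrow> \<bar>x z - x w\<bar> \<le> int d \<Longrightarrow> \<bar>\<rho> z - \<rho> w\<bar> \<le> int d \<Longrightarrow>
       2 * \<bar>x z - x w\<bar> \<le> int d + 4 \<and> 2 * \<bar>\<rho> z - \<rho> w\<bar> \<le> int d + 3"
    and level: "\<And>z w. z \<in> P \<Longrightarrow> w \<in> P \<Longrightarrow> z \<noteq> w \<Longrightarrow> \<rho> z = \<rho> w \<Longrightarrow> 2 * int d < \<bar>x z - x w\<bar>"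
begin

lemma isotone_x: "isotone x" and isotone_y: "isotone y"
  unfolding isotone_def using x_bij y_bij x_iso y_iso by (auto simp: bij_betw_def)

lemma card_strip:
  assumes bij: "bij_betw \<kappa> P {1..n}" and p: "p \<in> T" "\<kappa> p < \<kappa> (g p)"
  shows "int (card (strip \<kappa> p)) = \<kappa> (g p) - \<kappa> p"
proof -
  have "\<kappa> p \<in> {1..n}" "\<kappa> (g p) \<in> {1..n}" using bij p T_sub g_in bij_betwE by fastforce+
  then have "\<kappa> ` strip \<kappa> p = {\<kappa> p..<\<kappa> (g p)}"
    using bij_betw_imp_surj_on[OF bij] unfolding strip_def by fastforce
  moreover have "inj_on \<kappa> (strip \<kappa> p)"
    using bij unfolding strip_def bij_betw_def by (auto intro: inj_on_subset)
  ultimately have "card (strip \<kappa> p) = card {\<kappa> p..<\<kappa> (g p)}" using card_image by fastforce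
  then show ?thesis using p by simp
qed

lemma rho_mono: "z \<in> P \<Longrightarrow> w \<in> P \<Longrightarrow> y z \<le> y w \<Longrightarrow> \<rho> z \<le> \<rho> w"
  using y_expands[of w z] by force

text \<open>
  For a point \<open>p\<close> moved right and up, the strips between \<open>p\<close> and \<open>g p\<close> have together at least \<open>d + 2\<close>
  points, so a second chain meets both.  If it does so in a single point, that point lies in the rectangle
  spanned by \<open>p\<close> and \<open>g p\<close>; otherwise it has a point \<open>z\<close> in one strip, beyond the diagonal of \<open>p\<close> only
  slightly: with \<open>x + \<rho>\<close> minimal at \<open>p\<close> and by \<open>steps\<close>, \<open>z\<close> is too close to \<open>p\<close>.
\<close>

lemma no_right_up: "\<not> (\<exists>p\<in>T. x p < x (g p) \<and> y p < y (g p))"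
proof
  define Q where "Q = {p \<in> T. x p < x (g p) \<and> y p < y (g p)}"
  assume "\<exists>p\<in>T. x p < x (g p) \<and> y p < y (g p)"
  then have Q: "Q \<noteq> {}" "finite Q"
    using finite_subset[of Q P] finite_P T_sub unfolding Q_def by auto
  obtain q where q: "q \<in> Q" "\<And>r. r \<in> Q \<Longrightarrow> x q + \<rho> q \<le> x r + \<rho> r"
    using finite_has_least_image[OF Q(2,1), of "\<lambda>p. x p + \<rho> p"] by blast
  \<comment> \<open>Ties in \<open>x + \<rho>\<close> are broken by the largest \<open>x\<close>, as
    the second case below requires.\<close>
  define Q' where "Q' = {p \<in> Q. x p + \<rho> p = x q + \<rho> q}"
  have Q': "Q' \<noteq> {}" "finite Q'" using q Q unfolding Q'_def by auto
  obtain p where p': "p \<in> Q'" "\<And>r. r \<in> Q' \<Longrightarrow> x r \<le> x p"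
    using finite_has_least_image[OF Q'(2,1), of "\<lambda>p. - x p"] by auto
  have pQ: "p \<in> Q" and umin: "\<And>r. r \<in> Q \<Longrightarrow> x p + \<rho> p \<le> x r + \<rho> r"
    and xmax: "\<And>r. r \<in> Q \<Longrightarrow> x p + \<rho> p = x r + \<rho> r \<Longrightarrow> x r \<le> x p"
    using p' q unfolding Q'_def by auto
  have p: "p \<in> T" "x p < x (g p)" "y p < y (g p)" using pQ unfolding Q_def by auto
  have P: "p \<in> P" "g p \<in> P" using p T_sub g_in by auto
  have card: "int (card (strip x p)) = x (g p) - x p" "int (card (strip y p)) = y (g p) - y p"
    using card_strip x_bij y_bij p by auto
  have hd: "x (g p) - x p \<le> int d" and vd: "y (g p) - y p \<le> int d"
    using card card_strip_le[OF isotone_x p(1,2)] card_strip_le[OF isotone_y p(1,3)] card_X by linarith+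
  have \<rho>: "\<rho> p \<le> \<rho> (g p)" "\<rho> (g p) - \<rho> p \<le> y (g p) - y p"
    using rho_mono[OF P] y_expands[OF P] p by linarith+
  have sum: "int d + 2 \<le> (x (g p) - x p) + (\<rho> (g p) - \<rho> p)"
    using far[OF P] p \<rho> by fastforce
  have half: "2 * (x (g p) - x p) \<le> int d + 4" "2 * (\<rho> (g p) - \<rho> p) \<le> int d + 3"
    using steps[OF P] p hd vd \<rho> by auto
  have "card X + 2 \<le> card (strip x p) + card (strip y p)" using card sum \<rho> card_X by linarith
  from common_chain[OF isotone_x isotone_y p this]
  obtain z z' where z: "z \<in> strip x p" and z': "z' \<in> strip y p" and "z \<noteq> p" "z' \<noteq> p"
    and alt: "z = z' \<or> (z, z') \<in> G\<^sup>+ \<or> (z', z) \<in> G\<^sup>+" .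
  have zP: "z \<in> P" "x p \<le> x z" "x z < x (g p)" using z unfolding strip_def by auto
  have z'P: "z' \<in> P" "y p \<le> y z'" "y z' < y (g p)" using z' unfolding strip_def by auto
  from alt consider "z = z'" | "(z, z') \<in> G\<^sup>+" | "(z', z) \<in> G\<^sup>+" by blast
  then show False
  proof cases
    case 1
    \<comment> \<open>Inside the rectangle the distances to \<open>p\<close> and \<open>g p\<close>
      add up to at most \<open>2 * d\<close>, yet each is at least \<open>d + 2\<close>.\<close>
    have "\<rho> p \<le> \<rho> z" "\<rho> z \<le> \<rho> (g p)" using rho_mono P zP z'P 1 by auto
    moreover have "int d + 2 \<le> \<bar>x p - x z\<bar> + \<bar>\<rho> p - \<rho> z\<bar>"
      using far[OF P(1) zP(1)] \<open>z \<noteq> p\<close> by simp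
    moreover have "int d + 2 \<le> \<bar>x z - x (g p)\<bar> + \<bar>\<rho> z - \<rho> (g p)\<bar>"
      using far[OF zP(1) P(2)] zP by fastforce
    ultimately show False using zP hd vd \<rho> by linarith
  next
    case 2
    then have zT: "z \<in> T" by (meson G_D tranclD)
    \<comment> \<open>From at or above \<open>p\<close> the chain would jump past the strip of
      \<open>y\<close>. So \<open>z\<close> is below \<open>p\<close>, and reaching
      \<open>z'\<close> takes a first step upwards.\<close>
    have "y z < y p" using chain_leaves_strip[OF isotone_y p(1,3) 2] z'P by linarith
    then have "y z < y (g z)" using chain_mono[OF isotone_y 2] z'P by linarith
    moreover have "x z < x (g z)" using isotone_le[OF isotone_x p(1) zT] zP by linarith
    ultimately have zQ: "z \<in> Q" using zT unfolding Q_def by blast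
    have "\<rho> z \<le> \<rho> p" using rho_mono[OF zP(1) P(1)] \<open>y z < y p\<close> by simp
    moreover have "x p < x z"
      using \<open>z \<noteq> p\<close> zP(1) P(1) zP(2) inj_onD[OF bij_betw_imp_inj_on[OF x_bij], of z p] by fastforce
    moreover have "int d + 2 \<le> \<bar>x p - x z\<bar> + \<bar>\<rho> p - \<rho> z\<bar>"
      using far[OF P(1) zP(1)] \<open>z \<noteq> p\<close> by simp
    ultimately have "int d + 2 \<le> (x z - x p) + (\<rho> p - \<rho> z)" by simp
    \<comment> \<open>As \<open>x z < x (g p)\<close>, \<open>half\<close> bounds
      \<open>2 * (x z - x p)\<close> by \<open>d + 2\<close>, so the vertical gap is at least the
      horizontal one.\<close>
    then have "x z + \<rho> z \<le> x p + \<rho> p" using zP(3) half(1) by simp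
    then show False using xmax[OF zQ] umin[OF zQ] \<open>x p < x z\<close> by simp
  next
    case 3
    then have zT: "z' \<in> T" by (meson G_D tranclD)
    have "x z' < x p" using chain_leaves_strip[OF isotone_x p(1,2) 3] zP by linarith
    then have "x z' < x (g z')" using chain_mono[OF isotone_x 3] zP by linarith
    moreover have "y z' < y (g z')" using isotone_le[OF isotone_y p(1) zT] z'P by linarith
    ultimately have zQ: "z' \<in> Q" using zT unfolding Q_def by blast
    have r: "\<rho> p \<le> \<rho> z'" "\<rho> z' \<le> \<rho> (g p)" using rho_mono P z'P by auto
    \<comment> \<open>Strictness in \<open>y\<close> passes to \<open>\<rho>\<close> only up to
      ties. A tie would put the two points more than \<open>2 * d\<close> apart, but minimality at
      \<open>p\<close> allows at most \<open>d\<close> on either side of \<open>p\<close>.\<close>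
    have "\<rho> z' \<noteq> \<rho> (g p)"
    proof
      assume "\<rho> z' = \<rho> (g p)"
      then have "2 * int d < \<bar>x z' - x (g p)\<bar>" using level[OF z'P(1) P(2)] z'P by auto
      then show False using umin[OF zQ] r \<rho> p hd vd \<open>x z' < x p\<close> by linarith
    qed
    moreover have "int d + 2 \<le> \<bar>x p - x z'\<bar> + \<bar>\<rho> p - \<rho> z'\<bar>"
      using far[OF P(1) z'P(1)] \<open>z' \<noteq> p\<close> by simp
    ultimately have "\<rho> z' < \<rho> (g p)" "int d + 2 \<le> (x p - x z') + (\<rho> z' - \<rho> p)"
      using r \<open>x z' < x p\<close> by simp_all
    then show False using umin[OF zQ] half(2) by simp
  qed
qed

text \<open>Upside down, moves to the right and down become moves to the right and up.\<close>

lemma reflect: "shift_spread P X T g x (\<lambda>z. n + 1 - y z) (\<lambda>z. - \<rho> z) n d"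
proof (unfold_locales, fact card_X, fact x_bij)
  have "bij_betw (\<lambda>i. n + 1 - i) {1..n} {1..n}"
    by (rule bij_betwI[where g = "\<lambda>i. n + 1 - i"]) auto
  from bij_betw_trans[OF y_bij this] show "bij_betw (\<lambda>z. n + 1 - y z) P {1..n}"
    by (simp add: comp_def)
next
  fix z w assume "z \<in> P" "w \<in> P"
  then show "- \<rho> z < - \<rho> w \<Longrightarrow> - \<rho> w - - \<rho> z \<le> n + 1 - y w - (n + 1 - y z)"
    using y_expands[of w z] by simp
  show "z \<noteq> w \<Longrightarrow> int d + 2 \<le> \<bar>x z - x w\<bar> + \<bar>- \<rho> z - - \<rho> w\<bar>"
    using far[OF \<open>z \<in> P\<close> \<open>w \<in> P\<close>] by (simp add: abs_minus_commute)
  show "2 * \<bar>x z - x w\<bar> \<le> int d + 4 \<and> 2 * \<bar>- \<rho> z - - \<rho> w\<bar> \<le> int d + 3"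
    if "\<bar>x z - x w\<bar> \<le> int d" "\<bar>- \<rho> z - - \<rho> w\<bar> \<le> int d"
    using steps[OF \<open>z \<in> P\<close> \<open>w \<in> P\<close>] that by (simp add: abs_minus_commute)
  show "z \<noteq> w \<Longrightarrow> - \<rho> z = - \<rho> w \<Longrightarrow> 2 * int d < \<bar>x z - x w\<bar>"
    using level[OF \<open>z \<in> P\<close> \<open>w \<in> P\<close>] by simp
qed (use x_iso y_iso in auto)

text \<open>Reversing \<open>g\<close> turns leftward moves into rightward ones; the points deleted
  on the two sides exchange roles.\<close>

lemma inverse: "shift_spread P (P - T) (P - X) (inv_into T g) x y \<rho> n d"
proof (unfold_locales)
  have bij: "bij_betw g T (P - X)" using inj_g image_g by (simp add: bij_betw_def)
  have g_inv: "g (inv_into T g z) = z" "inv_into T g z \<in> T" if "z \<in> P - X" for z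
    using that bij by (auto simp: bij_betw_def f_inv_into_f inv_into_into)
  show "inj_on (inv_into T g) (P - X)" "inv_into T g ` (P - X) = P - (P - T)"
    using bij_betw_inv_into[OF bij] T_sub by (auto simp: bij_betw_def)
  have "card T = card (P - X)" using bij by (rule bij_betw_same_card)
  then show "card (P - T) = d"
    using card_X finite_P X_sub T_sub card_mono[OF finite_P X_sub]
    by (simp add: card_Diff_subset finite_subset)
  fix z w assume "z \<in> P - X" "w \<in> P - X"
  then show "x z < x w \<longleftrightarrow> x (inv_into T g z) < x (inv_into T g w)"
    "y z < y w \<longleftrightarrow> y (inv_into T g z) < y (inv_into T g w)"
    using x_iso y_iso g_inv by metis+
qed (use finite_P x_bij y_bij y_expands far steps level in auto)

text \<open>Reflection and inversion carry \<open>no_right_up\<close> to all four diagonal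
  directions, and a moved point changes both coordinates.\<close>

lemma g_fixes:
  assumes "p \<in> T"
  shows "g p = p"
proof (rule ccontr)
  assume "g p \<noteq> p"
  have P: "p \<in> P" "g p \<in> P" using assms T_sub g_in by auto
  then have ne: "x p \<noteq> x (g p)" "y p \<noteq> y (g p)"
    using \<open>g p \<noteq> p\<close> x_bij y_bij by (metis bij_betw_imp_inj_on inj_onD)+
  interpret r: shift_spread P X T g x "\<lambda>z. n + 1 - y z" "\<lambda>z. - \<rho> z" n d by (rule reflect)
  have "\<not> x p < x (g p)"
    using no_right_up r.no_right_up assms ne by fastforce
  moreover have "\<not> x (g p) < x p"
  proof
    assume "x (g p) < x p"
    moreover have "inv_into T g (g p) = p" using assms inj_g by simp
    moreover have "g p \<in> P - X" using assms g_in by blast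
    ultimately have "\<not> y (g p) < y p" "\<not> n + 1 - y (g p) < n + 1 - y p"
      using shift_spread.no_right_up[OF inverse] shift_spread.no_right_up[OF r.inverse] by metis+
    then show False using ne by simp
  qed
  ultimately show False using ne by simp
qed

end

section \<open>From order isomorphisms to separators\<close>

lemma pattern_copy_less_iff:
  assumes "a \<in> pattern_copies k \<pi> n \<sigma>" "i \<in> {1..k}" "j \<in> {1..k}"
  shows "\<sigma> (a i) < \<sigma> (a j) \<longleftrightarrow> \<pi> i < \<pi> j"
proof -
  have sgn: "sgn (int (\<sigma> (a j)) - int (\<sigma> (a i))) = sgn (int (\<pi> j) - int (\<pi> i))"
    if "i < j" "i \<in> {1..k}" "j \<in> {1..k}" for i j
    using assms(1) that unfolding pattern_copies_def by blast
  consider "i < j" | "i = j" | "j < i" by linarith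
  then show ?thesis
    by cases (use sgn[of i j] sgn[of j i] assms in \<open>auto simp: sgn_if split: if_splits\<close>)
qed

text \<open>For copies \<open>a\<close> and \<open>b\<close> of one pattern,
  \<open>b t \<mapsto> a t\<close> is an order isomorphism in both coordinates that misses
  \<open>d\<close> points, so \<open>g_fixes\<close> gives \<open>a = b\<close>.\<close>

lemma separatorI:
  fixes \<rho> :: "nat \<Rightarrow> int"
  assumes \<sigma>: "\<sigma> permutes {1..n}" and n: "n = k + d"
    and expands: "\<And>z w. z \<in> {1..n} \<Longrightarrow> w \<in> {1..n} \<Longrightarrow> \<rho> z < \<rho> w \<Longrightarrow> \<rho> w - \<rho> z \<le> int (\<sigma> w) - int (\<sigma> z)"
    and far: "\<And>z w. z \<in> {1..n} \<Longrightarrow> w \<in> {1..n} \<Longrightarrow> z \<noteq> w \<Longrightarrow>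
      int d + 2 \<le> \<bar>int z - int w\<bar> + \<bar>\<rho> z - \<rho> w\<bar>"
    and steps: "\<And>z w. z \<in> {1..n} \<Longrightarrow> w \<in> {1..n} \<Longrightarrow> \<bar>int z - int w\<bar> \<le> int d \<Longrightarrow> \<bar>\<rho> z - \<rho> w\<bar> \<le> int d \<Longrightarrow>
      2 * \<bar>int z - int w\<bar> \<le> int d + 4 \<and> 2 * \<bar>\<rho> z - \<rho> w\<bar> \<le> int d + 3"
    and level: "\<And>z w. z \<in> {1..n} \<Longrightarrow> w \<in> {1..n} \<Longrightarrow> z \<noteq> w \<Longrightarrow> \<rho> z = \<rho> w \<Longrightarrow> 2 * int d < \<bar>int z - int w\<bar>"
  shows "separator k n \<sigma>"
proof -
  have "a = b" if a: "a \<in> pattern_copies k \<pi> n \<sigma>" and b: "b \<in> pattern_copies k \<pi> n \<sigma>" for \<pi> a b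
  proof -
    let ?K = "{1..k}" and ?P = "{1..n}"
    have mono: "strict_mono_on ?K a" "strict_mono_on ?K b" and ext: "a \<in> ?K \<rightarrow>\<^sub>E ?P" "b \<in> ?K \<rightarrow>\<^sub>E ?P"
      using a b unfolding pattern_copies_def by auto
    then have inj: "inj_on a ?K" "inj_on b ?K" by (auto intro: strict_mono_on_imp_inj_on)
    define g where "g z = a (inv_into ?K b z)" for z
    have g: "g (b t) = a t" if "t \<in> ?K" for t using inj that unfolding g_def by simp
    have \<sigma>_bij: "bij_betw \<sigma> ?P ?P" using \<sigma> by (rule permutes_imp_bij)
    have int_bij: "bij_betw int ?P {1..int n}"
      by (rule bij_betwI[where g = nat]) auto
    have sub: "a ` ?K \<subseteq> ?P" "b ` ?K \<subseteq> ?P" using ext by auto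
    interpret shift_spread ?P "?P - a ` ?K" "b ` ?K" g int "\<lambda>z. int (\<sigma> z)" \<rho> "int n" d
    proof (unfold_locales)
      have "inj_on (g \<circ> b) ?K" using inj(1) inj_on_cong[of ?K "g \<circ> b" a] g by (metis comp_apply)
      then show "inj_on g (b ` ?K)" by (rule inj_on_imageI)
      have "g ` b ` ?K = a ` ?K" unfolding image_image by (rule image_cong) (use g in auto)
      then show "g ` b ` ?K = ?P - (?P - a ` ?K)" using sub by auto
      have "card (a ` ?K) = k" using card_image[OF inj(1)] by simp
      then show "card (?P - a ` ?K) = d" using sub n by (simp add: card_Diff_subset)
      show "bij_betw (\<lambda>z. int (\<sigma> z)) ?P {1..int n}"
        using bij_betw_trans[OF \<sigma>_bij int_bij] by (simp add: comp_def)
      fix z w assume "z \<in> b ` ?K" "w \<in> b ` ?K"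
      then obtain s t where st: "s \<in> ?K" "t \<in> ?K" "z = b s" "w = b t" by blast
      show "int z < int w \<longleftrightarrow> int (g z) < int (g w)"
        using st g strict_mono_on_less[OF mono(1)] strict_mono_on_less[OF mono(2)] by simp
      show "int (\<sigma> z) < int (\<sigma> w) \<longleftrightarrow> int (\<sigma> (g z)) < int (\<sigma> (g w))"
        using st g pattern_copy_less_iff[OF a st(1,2)] pattern_copy_less_iff[OF b st(1,2)] by simp
    qed (use sub int_bij expands far steps level in auto)
    have "a t = b t" if "t \<in> ?K" for t using g_fixes[of "b t"] g that by simp
    then show ?thesis using ext by (meson PiE_ext)
  qed
  moreover have "k \<le> n" using n by simp
  ultimately show ?thesis using \<sigma> unfolding separator_def Uniq_def by blast
qed

section \<open>Lattice permutations\<close>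

text \<open>For \<open>i = c * \<mu> + \<alpha>\<close> one has
  \<open>i + r = 2 * \<mu> * \<alpha>\<close>, which settles the norm unless
  \<open>\<alpha> = 0\<close>, when the vector is \<open>c\<close> times
  \<open>(\<mu>, - \<mu>)\<close>. In the box only zero, \<open>(\<mu>, - \<mu>)\<close>,
  \<open>(\<mu> + 1, \<mu> - 1)\<close> and their negatives can occur.\<close>

lemma lattice_even:
  fixes \<mu> i c r :: int
  assumes "\<mu> \<ge> 1" and r: "r = (2 * \<mu> - 1) * i - c * (2 * \<mu>\<^sup>2)"
  shows "i \<noteq> 0 \<or> r \<noteq> 0 \<Longrightarrow> 2 * \<mu> \<le> \<bar>i\<bar> + \<bar>r\<bar>"
    and "\<bar>i\<bar> \<le> 2 * \<mu> - 2 \<Longrightarrow> \<bar>r\<bar> \<le> 2 * \<mu> - 2 \<Longrightarrow> \<bar>i\<bar> \<le> \<mu> + 1 \<and> \<bar>r\<bar> \<le> \<mu>"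
proof -
  define \<alpha> where "\<alpha> = i - c * \<mu>"
  have i: "i = c * \<mu> + \<alpha>" and u: "i + r = 2 * \<mu> * \<alpha>"
    unfolding \<alpha>_def r by (auto simp: power2_eq_square algebra_simps)
  have below: "x \<le> y" if "x * \<mu> < (y + 1) * \<mu>" for x y
    using that \<open>\<mu> \<ge> 1\<close> by (simp add: mult_less_cancel_right_disj)
  show "2 * \<mu> \<le> \<bar>i\<bar> + \<bar>r\<bar>" if "i \<noteq> 0 \<or> r \<noteq> 0"
  proof (cases "\<alpha> = 0")
    case True
    then have "c \<noteq> 0" "i = c * \<mu>" "r = - i" using that i u by auto
    moreover from this have "1 * \<mu> \<le> \<bar>c\<bar> * \<mu>" using \<open>\<mu> \<ge> 1\<close> by (intro mult_right_mono) auto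
    ultimately show ?thesis using \<open>\<mu> \<ge> 1\<close> by (simp add: abs_mult)
  next
    case False
    then have "2 * \<mu> * 1 \<le> 2 * \<mu> * \<bar>\<alpha>\<bar>" using \<open>\<mu> \<ge> 1\<close> by (intro mult_left_mono) auto
    also have "\<dots> = \<bar>i + r\<bar>" using u \<open>\<mu> \<ge> 1\<close> by (simp add: abs_mult)
    finally show ?thesis by linarith
  qed
  show "\<bar>i\<bar> \<le> \<mu> + 1 \<and> \<bar>r\<bar> \<le> \<mu>" if small: "\<bar>i\<bar> \<le> 2 * \<mu> - 2" "\<bar>r\<bar> \<le> 2 * \<mu> - 2"
  proof -
    have "\<alpha> * \<mu> < (1 + 1) * \<mu>" "- \<alpha> * \<mu> < (1 + 1) * \<mu>"
      using small u by (simp_all add: algebra_simps)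
    then have "\<alpha> \<le> 1" "- \<alpha> \<le> 1" using below[of \<alpha> 1] below[of "- \<alpha>" 1] by blast+
    then consider "\<alpha> = 0" | "\<alpha> = 1" | "\<alpha> = -1" by linarith
    then show ?thesis
    proof cases
      case 1
      then have "c * \<mu> < (1 + 1) * \<mu>" "- c * \<mu> < (1 + 1) * \<mu>" using i small by simp_all
      then have "c \<le> 1" "- c \<le> 1" using below[of c 1] below[of "- c" 1] by blast+
      then consider "c = 0" | "c = 1" | "c = -1" by linarith
      then show ?thesis using 1 i u \<open>\<mu> \<ge> 1\<close> by cases auto
    next
      case 2
      then have "i + r = 2 * \<mu>" "c * \<mu> = i - 1" using i u by simp_all
      then have "c * \<mu> < (1 + 1) * \<mu>" "- c * \<mu> < (-1 + 1) * \<mu>" using small by simp_all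
      then have "c \<le> 1" "- c \<le> -1" using below[of c 1] below[of "- c" "-1"] by blast+
      then have "c = 1" by simp
      then show ?thesis using 2 i u \<open>\<mu> \<ge> 1\<close> by auto
    next
      case 3
      then have "i + r = - 2 * \<mu>" "c * \<mu> = i + 1" using i u by simp_all
      then have "c * \<mu> < (-1 + 1) * \<mu>" "- c * \<mu> < (1 + 1) * \<mu>" using small by simp_all
      then have "c \<le> -1" "- c \<le> 1" using below[of c "-1"] below[of "- c" 1] by blast+
      then have "c = -1" by simp
      then show ?thesis using 3 i u \<open>\<mu> \<ge> 1\<close> by auto
    qed
  qed
qed

text \<open>\<open>\<alpha>\<close> and \<open>\<beta>\<close> are the coordinates with respect to the lattice basis \<open>(\<mu> + 1, \<mu>)\<close>, \<open>(\<mu>, - \<mu> - 1)\<close>.\<close>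

lemma lattice_odd:
  fixes \<mu> i c r :: int
  assumes "\<mu> \<ge> 1" and r: "r = (2 * \<mu> + 1) * i - c * (2 * \<mu>\<^sup>2 + 2 * \<mu> + 1)"
  shows "i \<noteq> 0 \<or> r \<noteq> 0 \<Longrightarrow> 2 * \<mu> + 1 \<le> \<bar>i\<bar> + \<bar>r\<bar>"
    and "\<bar>i\<bar> \<le> 2 * \<mu> - 1 \<Longrightarrow> \<bar>r\<bar> \<le> 2 * \<mu> - 1 \<Longrightarrow> \<bar>i\<bar> \<le> \<mu> + 1 \<and> \<bar>r\<bar> \<le> \<mu> + 1"
proof -
  define \<alpha> \<beta> where "\<alpha> = i - \<mu> * c" and "\<beta> = (\<mu> + 1) * c - i"
  have i: "i = \<alpha> * (\<mu> + 1) + \<beta> * \<mu>" and r': "r = \<alpha> * \<mu> - \<beta> * (\<mu> + 1)"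
    unfolding \<alpha>_def \<beta>_def r by (auto simp: power2_eq_square algebra_simps)
  define m where "m = 2 * \<mu> + 1"
  \<comment> \<open>The norm is the larger of \<open>\<bar>i + r\<bar>\<close> and
    \<open>\<bar>i - r\<bar>\<close>.\<close>
  have u: "i + r = \<alpha> * m - \<beta>" and w: "i - r = \<alpha> + \<beta> * m"
    unfolding i r' m_def by (auto simp: algebra_simps)
  have m: "m \<ge> 3" using \<open>\<mu> \<ge> 1\<close> unfolding m_def by simp
  have up: "y * m \<le> x * m" if "y \<le> x" for x y using that m by (intro mult_right_mono) auto
  show "2 * \<mu> + 1 \<le> \<bar>i\<bar> + \<bar>r\<bar>" if "i \<noteq> 0 \<or> r \<noteq> 0"
  proof -
    have "\<alpha> \<noteq> 0 \<or> \<beta> \<noteq> 0" using that i r' by auto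
    then consider "\<alpha> \<ge> 1" "\<beta> \<le> 0" | "\<alpha> \<ge> 0" "\<beta> \<ge> 1" | "\<alpha> \<le> -1" "\<beta> \<ge> 0" | "\<alpha> \<le> 0" "\<beta> \<le> -1" by linarith
    then have "m \<le> \<bar>i + r\<bar> \<or> m \<le> \<bar>i - r\<bar>"
      unfolding u w using up[of 1 \<alpha>] up[of 1 \<beta>] up[of \<alpha> "-1"] up[of \<beta> "-1"] by cases auto
    then show ?thesis unfolding m_def by linarith
  qed
  show "\<bar>i\<bar> \<le> \<mu> + 1 \<and> \<bar>r\<bar> \<le> \<mu> + 1" if small: "\<bar>i\<bar> \<le> 2 * \<mu> - 1" "\<bar>r\<bar> \<le> 2 * \<mu> - 1"
  proof -
    have "\<bar>i + r\<bar> \<le> 2 * m - 4" "\<bar>i - r\<bar> \<le> 2 * m - 4"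
      using small abs_triangle_ineq[of i r] abs_triangle_ineq4[of i r] unfolding m_def by simp_all
    then have bounds: "\<alpha> * m - \<beta> \<le> 2 * m - 4" "\<beta> - \<alpha> * m \<le> 2 * m - 4"
      "\<alpha> + \<beta> * m \<le> 2 * m - 4" "- \<alpha> - \<beta> * m \<le> 2 * m - 4"
      unfolding u w by simp_all
    \<comment> \<open>A coefficient of size at least 2 pushes one of the four forms in
      \<open>bounds\<close> to at least \<open>2 * m - 1\<close>; the other coefficient decides
      which.\<close>
    have "\<not> 2 \<le> \<alpha>"
    proof
      assume *: "2 \<le> \<alpha>"
      show False
      proof (cases "2 \<le> \<beta>")
        case True
        then show False using bounds m up[OF True] up[OF *] * by linarith
      next
        case False
        then show False using bounds m up[OF *] * by linarith
      qed
    qed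
    moreover have "\<not> \<alpha> \<le> -2"
    proof
      assume *: "\<alpha> \<le> -2"
      show False
      proof (cases "\<beta> \<le> -2")
        case True
        then show False using bounds m up[OF True] up[OF *] * by linarith
      next
        case False
        then show False using bounds m up[OF *] * by linarith
      qed
    qed
    moreover have "\<not> 2 \<le> \<beta>"
    proof
      assume *: "2 \<le> \<beta>"
      show False
      proof (cases "\<alpha> \<le> -2")
        case True
        then show False using bounds m up[OF True] up[OF *] * by linarith
      next
        case False
        then show False using bounds m up[OF *] * by linarith
      qed
    qed
    moreover have "\<not> \<beta> \<le> -2"
    proof
      assume *: "\<beta> \<le> -2"
      show False
      proof (cases "2 \<le> \<alpha>")
        case True
        then show False using bounds m up[OF True] up[OF *] * by linarith
      next
        case False
        then show False using bounds m up[OF *] * by linarith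
      qed
    qed
    ultimately have "\<bar>\<alpha>\<bar> \<le> 1" "\<bar>\<beta>\<bar> \<le> 1" by linarith+
    then have "\<alpha> \<in> {-1, 0, 1}" "\<beta> \<in> {-1, 0, 1}" by auto
    \<comment> \<open>If both coefficients are nonzero, a coordinate has size
      \<open>2 * \<mu> + 1\<close>, contrary to \<open>small\<close>.\<close>
    then show ?thesis using small \<open>\<mu> \<ge> 1\<close> unfolding i r' by auto
  qed
qed

text \<open>By \<open>ab\<close>, \<open>a\<close> is invertible modulo \<open>N\<close>, so equal
  residues recur only at distance at least \<open>N\<close>, beyond \<open>2 * d\<close>. As
  \<open>N \<le> k + d\<close>, every residue occurs.\<close>

lemma lattice_separator:
  fixes a b N k d :: nat
  assumes ab: "a * b + 1 = 2 * N" and N: "N \<le> k + d" "2 * d < N"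
    and far: "\<And>i c r :: int. r = int a * i - c * int N \<Longrightarrow> i \<noteq> 0 \<or> r \<noteq> 0 \<Longrightarrow> int d + 2 \<le> \<bar>i\<bar> + \<bar>r\<bar>"
    and steps: "\<And>i c r :: int. r = int a * i - c * int N \<Longrightarrow> \<bar>i\<bar> \<le> int d \<Longrightarrow> \<bar>r\<bar> \<le> int d \<Longrightarrow>
      2 * \<bar>i\<bar> \<le> int d + 4 \<and> 2 * \<bar>r\<bar> \<le> int d + 3"
  shows "\<exists>\<sigma>. separator k (k + d) \<sigma>"
proof -
  define n where "n = k + d"
  define res where "res z = a * z mod N" for z
  \<comment> \<open>Ordering by \<open>\<kappa>\<close> is ordering by residues, with ties broken by position.\<close>
  define \<kappa> where "\<kappa> z = res z * (n + 1) + z" for z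
  have "N > 0" using N by simp
  have diff: "\<exists>c. int (res z) - int (res w) = int a * (int z - int w) - c * int N" for z w
  proof
    have "int a * int x = int (a * x div N) * int N + int (res x)" for x
      unfolding res_def by (simp flip: of_nat_mult of_nat_add)
    from this[of z] this[of w] show "int (res z) - int (res w) = int a * (int z - int w) - (int (a * z div N) - int (a * w div N)) * int N"
      by (simp add: algebra_simps)
  qed
  have same: "int N \<le> \<bar>int z - int w\<bar>" if "res z = res w" "z \<noteq> w" for z w
  proof -
    obtain c where "int (res z) - int (res w) = int a * (int z - int w) - c * int N" using diff by blast
    then have c: "int a * (int z - int w) = c * int N" using that by simp
    have "int a * int b = 2 * int N - 1" using arg_cong[OF ab, of int] by simp
    \<comment> \<open>Multiplying by \<open>b\<close> replaces \<open>a * b\<close> by -1 modulo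
      \<open>N\<close>.\<close>
    then have "(2 * int N - 1) * (int z - int w) = int b * (c * int N)"
      using c by (metis mult.assoc mult.commute)
    then have "int z - int w = int N * (2 * (int z - int w) - int b * c)" by (simp add: algebra_simps)
    then have "int N dvd \<bar>int z - int w\<bar>" by (metis dvd_abs_iff dvd_triv_left)
    then show ?thesis using that by (intro zdvd_imp_le) auto
  qed
  have \<kappa>_less: "\<kappa> z < \<kappa> w" if "res z < res w" "z \<in> {1..n}" for z w
  proof -
    have "(res z + 1) * (n + 1) \<le> res w * (n + 1)" using that by (intro mult_right_mono) auto
    then show ?thesis using that unfolding \<kappa>_def by simp
  qed
  have "inj_on \<kappa> {1..n}"
  proof (rule inj_onI)
    fix z w assume zw: "z \<in> {1..n}" "w \<in> {1..n}" and eq: "\<kappa> z = \<kappa> w"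
    have "res z = res w" using \<kappa>_less[of z w] \<kappa>_less[of w z] zw eq by fastforce
    then show "z = w" using eq unfolding \<kappa>_def by simp
  qed
  then obtain \<sigma> where \<sigma>: "\<sigma> permutes {1..n}" "\<And>x. x \<in> {1..n} \<Longrightarrow> \<sigma> x = rank \<kappa> {1..n} x"
    using ex_permutes_rank by blast
  have res_onto: "\<exists>u\<in>{1..n}. res u = c" if "c < N" for c
  proof -
    have "inj_on res {1..N}"
    proof (rule inj_onI)
      fix z w assume "z \<in> {1..N}" "w \<in> {1..N}" "res z = res w"
      then show "z = w" using same[of z w] by fastforce
    qed
    moreover have sub: "res ` {1..N} \<subseteq> {..<N}" using \<open>N > 0\<close> unfolding res_def by auto
    ultimately have "res ` {1..N} = {..<N}" by (intro card_subset_eq) (auto simp: card_image)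
    then have "c \<in> res ` {1..N}" using that by simp
    then show ?thesis using N(1) unfolding n_def by fastforce
  qed
  have expands: "int (res w) - int (res z) \<le> int (\<sigma> w) - int (\<sigma> z)"
    if zw: "z \<in> {1..n}" "w \<in> {1..n}" "int (res z) < int (res w)" for z w
  proof -
    define below where "below x = {u \<in> {1..n}. \<kappa> u \<le> \<kappa> x}" for x
    have "\<kappa> z < \<kappa> w" using \<kappa>_less zw by simp
    then have sub: "below z \<subseteq> below w" unfolding below_def by auto
    have fin: "finite (below x)" for x unfolding below_def by simp
    \<comment> \<open>Each residue in this range is attained by a point after \<open>z\<close> and
      not after \<open>w\<close>, so ranks grow at least as fast as residues.\<close>
    have "{res z<..res w} \<subseteq> res ` (below w - below z)"
    proof
      fix c assume c: "c \<in> {res z<..res w}"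
      have "res w < N" using \<open>N > 0\<close> unfolding res_def by simp
      show "c \<in> res ` (below w - below z)"
      proof (cases "c = res w")
        case True
        then show ?thesis using zw \<open>\<kappa> z < \<kappa> w\<close> unfolding below_def by auto
      next
        case False
        then obtain u where u: "u \<in> {1..n}" "res u = c" using res_onto[of c] c \<open>res w < N\<close> by auto
        then have "\<kappa> z < \<kappa> u" "\<kappa> u < \<kappa> w" using \<kappa>_less[of z u] \<kappa>_less[of u w] zw c False by auto
        then show ?thesis using u unfolding below_def by auto
      qed
    qed
    then have "card {res z<..res w} \<le> card (below w - below z)" using fin by (intro surj_card_le) auto
    then have "res w - res z \<le> card (below w) - card (below z)"
      using fin sub by (simp add: card_Diff_subset)
    moreover have "card (below z) \<le> card (below w)" using sub fin by (intro card_mono)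
    ultimately show ?thesis using \<sigma>(2) zw unfolding rank_def below_def[symmetric] by simp
  qed
  have "separator k n \<sigma>"
  proof (rule separatorI[where \<rho> = "\<lambda>z. int (res z)" and d = d])
    fix z w :: nat
    obtain c where c: "int (res z) - int (res w) = int a * (int z - int w) - c * int N"
      using diff by blast
    show "z \<noteq> w \<Longrightarrow> int d + 2 \<le> \<bar>int z - int w\<bar> + \<bar>int (res z) - int (res w)\<bar>"
      using far[OF c] by simp
    show "2 * \<bar>int z - int w\<bar> \<le> int d + 4 \<and> 2 * \<bar>int (res z) - int (res w)\<bar> \<le> int d + 3"
      if "\<bar>int z - int w\<bar> \<le> int d" "\<bar>int (res z) - int (res w)\<bar> \<le> int d"
      using steps[OF c that] .
    show "2 * int d < \<bar>int z - int w\<bar>" if "z \<noteq> w" "int (res z) = int (res w)"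
      using same[of z w] that N(2) by simp
  qed (use \<sigma>(1) n_def expands in auto)
  then show ?thesis unfolding n_def by blast
qed

text \<open>The hypothesis amounts to \<open>N \<le> k + d\<close>: exactly for even
  \<open>d\<close>, and for odd \<open>d\<close> because \<open>(d + 1)\<^sup>2 + 3\<close> is then
  odd.\<close>

lemma ex_separator:
  assumes "(d + 1)\<^sup>2 + 3 \<le> 2 * k"
  shows "\<exists>\<sigma>. separator k (k + d) \<sigma>"
proof (cases "even d")
  case True
  then obtain e where e: "d = 2 * e" by blast
  show ?thesis
  proof (rule lattice_separator[where a = "2 * e + 1" and b = "2 * e + 3" and N = "2 * (e + 1)\<^sup>2"])
    fix i c r :: int assume r: "r = int (2 * e + 1) * i - c * int (2 * (e + 1)\<^sup>2)"
    have r': "r = (2 * (int e + 1) - 1) * i - c * (2 * (int e + 1)\<^sup>2)" unfolding r by (simp add: add.commute)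
    show "i \<noteq> 0 \<or> r \<noteq> 0 \<Longrightarrow> int d + 2 \<le> \<bar>i\<bar> + \<bar>r\<bar>" using lattice_even(1)[OF _ r'] e by simp
    show "\<bar>i\<bar> \<le> int d \<Longrightarrow> \<bar>r\<bar> \<le> int d \<Longrightarrow> 2 * \<bar>i\<bar> \<le> int d + 4 \<and> 2 * \<bar>r\<bar> \<le> int d + 3"
      using lattice_even(2)[OF _ r'] e by simp
  qed (use assms e in \<open>auto simp: power2_eq_square algebra_simps\<close>)
next
  case False
  then obtain e where e: "d = 2 * e + 1" using oddE by blast
  show ?thesis
  proof (rule lattice_separator[where a = "2 * e + 3" and b = "2 * e + 3" and N = "2 * (e + 1)\<^sup>2 + 2 * (e + 1) + 1"])
    fix i c r :: int assume r: "r = int (2 * e + 3) * i - c * int (2 * (e + 1)\<^sup>2 + 2 * (e + 1) + 1)"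
    have r': "r = (2 * (int e + 1) + 1) * i - c * (2 * (int e + 1)\<^sup>2 + 2 * (int e + 1) + 1)"
      unfolding r by (simp add: algebra_simps)
    show "i \<noteq> 0 \<or> r \<noteq> 0 \<Longrightarrow> int d + 2 \<le> \<bar>i\<bar> + \<bar>r\<bar>" using lattice_odd(1)[OF _ r'] e by simp
    show "\<bar>i\<bar> \<le> int d \<Longrightarrow> \<bar>r\<bar> \<le> int d \<Longrightarrow> 2 * \<bar>i\<bar> \<le> int d + 4 \<and> 2 * \<bar>r\<bar> \<le> int d + 3"
      using lattice_odd(2)[OF _ r'] e by simp
  qed (use assms e in \<open>auto simp: power2_eq_square algebra_simps\<close>)
qed

section \<open>The value of \<open>F\<close>\<close>

theorem theorem1p2:
  fixes k :: nat
  assumes "k \<ge> 2"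
  shows "F k \<in> separator_lengths k \<and> (\<forall>n\<in>separator_lengths k. n \<le> F k) \<and>
         (\<exists>\<epsilon>\<in>{-1, 0 :: int}. int (F k) = int k + \<lfloor>sqrt (2 * real k - 3)\<rfloor> + \<epsilon>)"
proof -
  let ?s = "\<lfloor>sqrt (2 * real k - 3)\<rfloor>"
  have "1 \<le> ?s" using assms by simp
  \<comment> \<open>The construction with this \<open>d\<close> attains \<epsilon> = -1; the upper
    bound allows one more.\<close>
  then obtain d where d: "?s = int d + 1" by (metis add.commute zle_iff_zadd of_nat_1)
  have "real (d + 1) \<le> sqrt (2 * real k - 3)" using d by (metis of_int_floor_le of_int_of_nat_eq of_nat_1 of_nat_add)
  then have "(real (d + 1))\<^sup>2 \<le> (sqrt (2 * real k - 3))\<^sup>2" by (intro power_mono) auto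
  then have "real ((d + 1)\<^sup>2 + 3) \<le> real (2 * k)" using assms by simp
  then have low: "k + d \<in> separator_lengths k"
    unfolding separator_lengths_def using ex_separator of_nat_le_iff by blast
  have bound: "n \<le> k + d + 1" if "n \<in> separator_lengths k" for n
  proof -
    obtain \<sigma> where \<sigma>: "separator k n \<sigma>" using \<open>n \<in> separator_lengths k\<close> unfolding separator_lengths_def by blast
    then obtain e where e: "n = k + e" unfolding separator_def using le_Suc_ex by blast
    have "real (e\<^sup>2 + 3) \<le> real (2 * k)" using separator_bound[of k e \<sigma>] \<sigma> e assms of_nat_le_iff by blast
    then have "real e \<le> sqrt (2 * real k - 3)" by (intro real_le_rsqrt) simp
    then have "int e \<le> ?s" by (simp add: le_floor_iff)
    then show ?thesis using d e by simp
  qed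
  then have fin: "finite (separator_lengths k)" by (meson finite_nat_set_iff_bounded_le)
  have F: "F k \<in> separator_lengths k" "\<forall>n\<in>separator_lengths k. n \<le> F k"
    unfolding F_def using Max_in[OF fin] Max_ge[OF fin] low by auto
  then have "F k = k + d \<or> F k = k + d + 1" using low bound by (metis Suc_eq_plus1 le_Suc_eq le_antisym)
  then show ?thesis using F d by auto
qed

end
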